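(* Let $\sigma>0$ with $\frac{1}{2\sigma}\notin\mathbb{N}$. Consider the two-velocity system for $2\pi$-periodic functions $f_\pm(x,t)$, $$\partial_tf_\pm\pm\sigma\partial_xf_\pm=\pm\tfrac12(f_--f_+),\qquad t\ge0,$$ with initial data $f^I=(f_+^I,f_-^I)^\top\in L^2(0,2\pi;\mathbb{R}^2)$, and let $f^\infty=(f_+^\infty,f_-^\infty)^\top$ be the constant state $f_+^\infty=f_-^\infty=\frac1{4\pi}\int_0^{2\pi}(f_+^I(x)+f_-^I(x))\,\mathrm{d}x$. Then the solution $f=(f_+,f_-)^\top$ satisfies $$\|f(t)-f^\infty\|_{L^2(0,2\pi;\mathbb{R}^2)}\le c\,e^{-\lambda t}\|f^I-f^\infty\|_{L^2(0,2\pi;\mathbb{R}^2)},\qquad t\ge0,$$ with $\lambda=\operatorname{Re}\big(\tfrac12-\sqrt{\tfrac14-\sigma^2}\big)$ and some constant $c>0$. *)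

theory Defs
  imports "HOL-Analysis.Analysis"
begin

definition L2_per :: "(real \<Rightarrow> real) \<Rightarrow> bool" where
  "L2_per g \<longleftrightarrow> g \<in> borel_measurable (restrict_space lborel {0..2*pi})
     \<and> set_integrable lborel {0..2*pi} (\<lambda>x. (g x)\<^sup>2)"

definition L2_norm2 :: "(real \<Rightarrow> real) \<Rightarrow> (real \<Rightarrow> real) \<Rightarrow> real" where
  "L2_norm2 gp gm = sqrt (LINT x:{0..2*pi}|lborel. (gp x)\<^sup>2 + (gm x)\<^sup>2)"

definition smooth_periodic :: "(real \<Rightarrow> real) \<Rightarrow> bool" where
  "smooth_periodic \<psi> \<longleftrightarrow> (\<forall>n. (deriv ^^ n) \<psi> differentiable_on UNIV)
      \<and> (\<forall>x. \<psi> (x + 2*pi) = \<psi> x)"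

text \<open>Solution of the two-velocity system
  d/dt f_+ + sigma d/dx f_+ =  (f_- - f_+)/2,
  d/dt f_- - sigma d/dx f_- = -(f_- - f_+)/2,
  for 2pi-periodic functions, with initial data (fIp, fIm).
  Functions are written f x t.  The equation is understood weakly in x
  (tested against smooth 2pi-periodic functions) and strongly in t >= 0,
  with f(t) in L2 for every t >= 0 and f(.,0) = f^I almost everywhere.\<close>
definition two_velocity_solution ::
  "real \<Rightarrow> (real \<Rightarrow> real) \<Rightarrow> (real \<Rightarrow> real) \<Rightarrow>
   (real \<Rightarrow> real \<Rightarrow> real) \<Rightarrow> (real \<Rightarrow> real \<Rightarrow> real) \<Rightarrow> bool" where
  "two_velocity_solution \<sigma> fIp fIm fp fm \<longleftrightarrow>
     (\<forall>t\<ge>0. L2_per (\<lambda>x. fp x t) \<and> L2_per (\<lambda>x. fm x t))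
   \<and> (AE x in lborel. x \<in> {0..2*pi} \<longrightarrow> fp x 0 = fIp x \<and> fm x 0 = fIm x)
   \<and> (\<forall>\<psi>. smooth_periodic \<psi> \<longrightarrow> (\<forall>t\<ge>0.
        ((\<lambda>s. LINT x:{0..2*pi}|lborel. fp x s * \<psi> x) has_real_derivative
           (LINT x:{0..2*pi}|lborel.
               \<sigma> * fp x t * deriv \<psi> x + (1/2) * (fm x t - fp x t) * \<psi> x))
          (at t within {0..})
      \<and> ((\<lambda>s. LINT x:{0..2*pi}|lborel. fm x s * \<psi> x) has_real_derivative
           (LINT x:{0..2*pi}|lborel.
               - \<sigma> * fm x t * deriv \<psi> x - (1/2) * (fm x t - fp x t) * \<psi> x))
          (at t within {0..})))"

end

theory Submission
  imports Defs
begin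

text \<open>In the Fourier variables the system decouples into \<open>2\<times>2\<close> systems
  \<open>y' = - \<kappa> z\<close>, \<open>z' = \<kappa> y - z\<close> with \<open>\<kappa> = \<sigma>\<bar>k\<bar>\<close>.  For each of them
  \<open>y\<^sup>2 + z\<^sup>2 - 2 \<theta> y z\<close>, with \<open>\<theta> = 2\<kappa>\<close> if \<open>\<kappa> < 1/2\<close> and
  \<open>\<theta> = 1/(2\<kappa>)\<close> otherwise, is a Lyapunov function that decays at the sharp rate.  It is
  comparable to \<open>y\<^sup>2 + z\<^sup>2\<close> uniformly in \<open>k\<close>, because \<open>1/(2\<sigma>) \<notin> \<nat>\<close> keeps \<open>\<kappa>\<close>
  away from the defective value \<open>1/2\<close>.  Parseval's identity sums the modes.\<close>

section \<open>The period interval and square-integrable functions\<close>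

text \<open>The equation only provides time derivatives of pairings with smooth periodic functions,
  so the norm of a solution cannot be differentiated directly. Differentiation in time is therefore
  done one coefficient at a time, and the norm is recovered at each fixed time as a limit of finite
  sums of modes. This needs completeness of the trigonometric system, obtained from
  Stone-Weierstrass on the circle, and a constant that is the same for all modes. Along a mode,
  \<open>y\<^sup>2 + z\<^sup>2\<close> has derivative \<open>- 2 * z\<^sup>2\<close>, which vanishes
  wherever \<open>z = 0\<close>; the cross term makes the dissipation visible in \<open>y\<close>.
  At \<kappa> = 1/2 both formulas give \<theta> = 1 and the form collapses to
  \<open>(y - z)\<^sup>2\<close>: the system then has a Jordan block, whose factor linear in time
  rules out a pure exponential at the sharp rate.\<close>

definition period_measure :: "real measure" where
  "period_measure = restrict_space lborel {0..2*pi}"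

lemma period_lborel_Int: "{0..2*pi} \<inter> space lborel \<in> sets lborel"
  by simp

lemma space_period_measure [simp]: "space period_measure = {0..2*pi}"
  by (simp add: period_measure_def space_restrict_space)

lemma set_integral_period: "(LINT x:{0..2*pi}|lborel. f x) = (LINT x|period_measure. f x)"
  for f :: "real \<Rightarrow> real"
  unfolding period_measure_def set_lebesgue_integral_def
  by (rule integral_restrict_space[OF period_lborel_Int, symmetric])

lemma set_integrable_period: "set_integrable lborel {0..2*pi} f \<longleftrightarrow> integrable period_measure f"
  for f :: "real \<Rightarrow> real"
  unfolding period_measure_def set_integrable_def
  by (rule integrable_restrict_space[OF period_lborel_Int, symmetric])

lemma finite_measure_period: "finite_measure period_measure"
  by (rule finite_measureI) (simp add: period_measure_def emeasure_restrict_space space_restrict_space)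

interpretation period: finite_measure period_measure
  by (rule finite_measure_period)

lemma AE_period_iff: "(AE x in period_measure. P x) \<longleftrightarrow> (AE x in lborel. x \<in> {0..2*pi} \<longrightarrow> P x)"
  unfolding period_measure_def by (rule AE_restrict_space_iff[OF period_lborel_Int])

lemma L2_per_iff:
  "L2_per f \<longleftrightarrow> f \<in> borel_measurable period_measure \<and> integrable period_measure (\<lambda>x. (f x)\<^sup>2)"
  unfolding L2_per_def set_integrable_period period_measure_def ..

lemma L2_per_measurable: "L2_per f \<Longrightarrow> f \<in> borel_measurable period_measure"
  by (simp add: L2_per_iff)

lemma L2_per_square: "L2_per f \<Longrightarrow> integrable period_measure (\<lambda>x. (f x)\<^sup>2)"
  by (simp add: L2_per_iff)

lemma L2_per_mult:
  assumes "L2_per f" "L2_per g"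
  shows "integrable period_measure (\<lambda>x. f x * g x)"
proof (rule Bochner_Integration.integrable_bound)
  show "integrable period_measure (\<lambda>x. (f x)\<^sup>2 + (g x)\<^sup>2)"
    using assms by (simp add: L2_per_iff)
  show "(\<lambda>x. f x * g x) \<in> borel_measurable period_measure"
    using assms by (intro borel_measurable_times L2_per_measurable)
  have "\<bar>a * b\<bar> \<le> a\<^sup>2 + b\<^sup>2" for a b :: real
  proof -
    have "2 * (\<bar>a\<bar> * \<bar>b\<bar>) \<le> a\<^sup>2 + b\<^sup>2"
      using sum_squares_bound[of "\<bar>a\<bar>" "\<bar>b\<bar>"] by (simp add: mult.assoc)
    moreover have "0 \<le> \<bar>a\<bar> * \<bar>b\<bar>" by simp
    ultimately show ?thesis unfolding abs_mult by linarith
  qed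
  then show "AE x in period_measure. norm (f x * g x) \<le> norm ((f x)\<^sup>2 + (g x)\<^sup>2)"
    by simp
qed

lemma L2_per_bounded:
  assumes "f \<in> borel_measurable period_measure" "\<And>x. x \<in> {0..2*pi} \<Longrightarrow> \<bar>f x\<bar> \<le> B"
  shows "L2_per f"
  unfolding L2_per_iff
proof
  show "integrable period_measure (\<lambda>x. (f x)\<^sup>2)"
  proof (rule period.integrable_const_bound)
    show "AE x in period_measure. norm ((f x)\<^sup>2) \<le> B\<^sup>2"
      using power_mono[OF assms(2), of _ 2] by (intro AE_I2) simp
  qed (use assms in simp)
qed fact

lemma continuous_on_measurable_period:
  fixes f :: "real \<Rightarrow> real"
  assumes "continuous_on UNIV f"
  shows "f \<in> borel_measurable period_measure"
  unfolding period_measure_def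
  by (rule measurable_restrict_space1)
    (use borel_measurable_continuous_onI[OF assms] in simp)

lemma L2_per_continuous:
  assumes "continuous_on UNIV f"
  shows "L2_per f"
proof -
  have "compact (f ` {0..2*pi})"
    by (intro compact_continuous_image continuous_on_subset[OF assms]) auto
  then have "bounded (f ` {0..2*pi})" by (rule compact_imp_bounded)
  then obtain B where "\<forall>x\<in>{0..2*pi}. \<bar>f x\<bar> \<le> B"
    unfolding bounded_iff by auto
  then have "\<And>x. x \<in> {0..2*pi} \<Longrightarrow> \<bar>f x\<bar> \<le> B" by blast
  then show ?thesis
    by (rule L2_per_bounded[OF continuous_on_measurable_period[OF assms]])
qed

lemma L2_per_add:
  assumes "L2_per f" "L2_per g"
  shows "L2_per (\<lambda>x. f x + g x)"
  unfolding L2_per_iff power2_sum mult.assoc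
  using L2_per_mult[OF assms] assms[THEN L2_per_square] assms[THEN L2_per_measurable]
  by (auto intro: borel_measurable_add)

lemma L2_per_cmult:
  assumes "L2_per f"
  shows "L2_per (\<lambda>x. c * f x)"
  unfolding L2_per_iff power_mult_distrib
  using L2_per_square[OF assms] L2_per_measurable[OF assms]
  by (auto intro: borel_measurable_times)

lemma L2_per_const: "L2_per (\<lambda>x. c)"
  by (intro L2_per_continuous continuous_intros)

lemma L2_per_diff:
  assumes "L2_per f" "L2_per g"
  shows "L2_per (\<lambda>x. f x - g x)"
  using L2_per_add[OF assms(1) L2_per_cmult[OF assms(2), of "-1"]] by simp

lemma L2_per_sum:
  assumes "finite I" "\<And>i. i \<in> I \<Longrightarrow> L2_per (f i)"
  shows "L2_per (\<lambda>x. \<Sum>i\<in>I. f i x)"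
  using assms by (induction I rule: finite_induct) (auto intro: L2_per_const L2_per_add)

lemma L2_per_integrable: "L2_per f \<Longrightarrow> integrable period_measure f"
  using L2_per_mult[OF _ L2_per_const[of 1], of f] by simp

text \<open>A triangle inequality for squared distances: the factor 2 replaces Minkowski's
  inequality and is harmless in density arguments.\<close>

lemma L2_dist_triangle:
  assumes "L2_per f" "L2_per g" "L2_per h"
  shows "(LINT x|period_measure. (f x - h x)\<^sup>2)
     \<le> 2 * (LINT x|period_measure. (f x - g x)\<^sup>2) + 2 * (LINT x|period_measure. (g x - h x)\<^sup>2)"
proof -
  note i = L2_per_square[OF L2_per_diff]
  have "(LINT x|period_measure. (f x - h x)\<^sup>2)
     \<le> (LINT x|period_measure. 2 * (f x - g x)\<^sup>2 + 2 * (g x - h x)\<^sup>2)"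
  proof (rule integral_mono)
    fix x
    show "(f x - h x)\<^sup>2 \<le> 2 * (f x - g x)\<^sup>2 + 2 * (g x - h x)\<^sup>2"
      using sum_squares_bound[of "f x - g x" "g x - h x"] 
      by (simp add: power2_eq_square algebra_simps)
  qed (use assms in \<open>auto intro!: i\<close>)
  then show ?thesis
    using i[OF assms(1,2)] i[OF assms(2,3)] by simp
qed

section \<open>The trigonometric system\<close>

text \<open>One integer index covers cosines and sines, with the sign selecting the kind.
  Differentiation then sends mode \<open>k\<close> to \<open>k\<close> times mode
  \<open>- k\<close>, with no separate sign rule for the two kinds.\<close>

definition trig :: "int \<Rightarrow> real \<Rightarrow> real" where
  "trig k x = (if k \<ge> 0 then cos (real_of_int k * x) else sin (real_of_int k * x))"

text \<open>Reciprocals of the squared norms of the unnormalised modes.\<close>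

definition trig_weight :: "int \<Rightarrow> real" where
  "trig_weight k = (if k = 0 then 1 / (2*pi) else 1 / pi)"

lemma continuous_on_trig: "continuous_on UNIV (trig k)"
  unfolding trig_def by (cases "k \<ge> 0") (auto intro!: continuous_intros)

lemma L2_per_trig: "L2_per (trig k)"
  by (rule L2_per_continuous[OF continuous_on_trig])

lemma integral_period_FTC:
  fixes F f :: "real \<Rightarrow> real"
  assumes "\<And>x. (F has_real_derivative f x) (at x)" "continuous_on UNIV f"
  shows "(LINT x|period_measure. f x) = F (2*pi) - F 0"
proof -
  have "(\<integral>x. indicator {0..2*pi} x *\<^sub>R f x \<partial>lborel) = F (2*pi) - F 0"
  proof (rule integral_FTC_Icc)
    fix x
    show "(F has_vector_derivative f x) (at x within {0..2*pi})"
      using assms(1)[of x] has_field_derivative_at_within has_real_derivative_iff_has_vector_derivative by blast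
  qed (use assms(2) continuous_on_subset in auto)
  then show ?thesis
    unfolding set_integral_period[symmetric] set_lebesgue_integral_def by simp
qed

lemma integral_cos_int:
  "(LINT x|period_measure. cos (real_of_int k * x)) = (if k = 0 then 2*pi else 0)"
proof (cases "k = 0")
  case True
  have "(LINT x|period_measure. 1) = 2 * pi - (0::real)"
    by (rule integral_period_FTC) (auto intro!: derivative_eq_intros)
  with True show ?thesis by simp
next
  case False
  then have "(LINT x|period_measure. cos (real_of_int k * x))
      = sin (real_of_int k * (2*pi)) / real_of_int k - sin (real_of_int k * 0) / real_of_int k"
    by (intro integral_period_FTC) (auto intro!: derivative_eq_intros continuous_intros)
  moreover have "sin (real_of_int k * (2*pi)) = 0"
    by (metis mult.commute sin_int_2pin)
  ultimately show ?thesis using False by simp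
qed

lemma integral_sin_int: "(LINT x|period_measure. sin (real_of_int k * x)) = 0"
proof (cases "k = 0")
  case False
  then have "(LINT x|period_measure. sin (real_of_int k * x))
      = - cos (real_of_int k * (2*pi)) / real_of_int k - - cos (real_of_int k * 0) / real_of_int k"
    by (intro integral_period_FTC) (auto intro!: derivative_eq_intros continuous_intros)
  moreover have "cos (real_of_int k * (2*pi)) = 1"
    by (metis mult.commute cos_int_2pin)
  ultimately show ?thesis using False by simp
qed simp

lemma trig_mult:
  "cos (real_of_int j * x) * cos (real_of_int k * x)
     = cos (real_of_int (j - k) * x) / 2 + cos (real_of_int (j + k) * x) / 2"
  "sin (real_of_int j * x) * sin (real_of_int k * x)
     = cos (real_of_int (j - k) * x) / 2 - cos (real_of_int (j + k) * x) / 2"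
  "sin (real_of_int j * x) * cos (real_of_int k * x)
     = sin (real_of_int (j + k) * x) / 2 + sin (real_of_int (j - k) * x) / 2"
  "cos (real_of_int j * x) * sin (real_of_int k * x)
     = sin (real_of_int (j + k) * x) / 2 - sin (real_of_int (j - k) * x) / 2"
  by (simp_all add: cos_times_cos sin_times_sin sin_times_cos cos_times_sin
      distrib_right left_diff_distrib add_divide_distrib diff_divide_distrib)

lemma trig_orthogonal:
  "(LINT x|period_measure. trig j x * trig k x) = (if j = k then 1 / trig_weight k else 0)"
proof -
  have c: "integrable period_measure (\<lambda>x. cos (real_of_int k * x))" for k
    by (intro L2_per_integrable L2_per_continuous continuous_intros)
  have s: "integrable period_measure (\<lambda>x. sin (real_of_int k * x))" for k
    by (intro L2_per_integrable L2_per_continuous continuous_intros)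
  \<comment> \<open>The frequencies must stay of the form \<open>real_of_int (j - k)\<close> and
    \<open>real_of_int (j + k)\<close>, so that the integrals at an integer frequency apply; hence
    the deleted simp rules.\<close>
  show ?thesis
    using c s
    by (cases "j \<ge> 0"; cases "k \<ge> 0")
      (auto simp: trig_def trig_mult integral_cos_int integral_sin_int trig_weight_def
        simp del: of_int_add of_int_diff)
qed

section \<open>Best approximation and Parseval's identity\<close>

definition trig_coeff :: "int \<Rightarrow> (real \<Rightarrow> real) \<Rightarrow> real" where
  "trig_coeff k f = (LINT x|period_measure. f x * trig k x)"

definition trig_energy :: "nat \<Rightarrow> (real \<Rightarrow> real) \<Rightarrow> real" where
  "trig_energy N f = (\<Sum>k\<in>{- int N..int N}. trig_weight k * (trig_coeff k f)\<^sup>2)"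

lemma trig_weight_pos: "trig_weight k > 0"
  by (simp add: trig_weight_def)

lemma integral_trig_sum:
  assumes "L2_per f" "finite I"
  shows "(LINT x|period_measure. f x * (\<Sum>k\<in>I. c k * trig k x)) = (\<Sum>k\<in>I. c k * trig_coeff k f)"
proof -
  have "(LINT x|period_measure. f x * (\<Sum>k\<in>I. c k * trig k x))
     = (LINT x|period_measure. (\<Sum>k\<in>I. c k * (f x * trig k x)))"
    by (simp add: sum_distrib_left mult_ac)
  also have "\<dots> = (\<Sum>k\<in>I. c k * trig_coeff k f)"
    unfolding trig_coeff_def using L2_per_mult[OF assms(1) L2_per_trig]
    by (subst Bochner_Integration.integral_sum) auto
  finally show ?thesis .
qed

lemma L2_per_trig_sum:
  assumes "finite I"
  shows "L2_per (\<lambda>x. \<Sum>k\<in>I. c k * trig k x)"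
  by (intro L2_per_sum L2_per_cmult L2_per_trig assms)

lemma trig_coeff_trig_sum:
  assumes "finite I" "j \<in> I"
  shows "trig_coeff j (\<lambda>x. \<Sum>k\<in>I. c k * trig k x) = c j / trig_weight j"
proof -
  have "trig_coeff j (\<lambda>x. \<Sum>k\<in>I. c k * trig k x) = (\<Sum>k\<in>I. c k * trig_coeff k (trig j))"
    unfolding integral_trig_sum[OF L2_per_trig assms(1), symmetric]
    unfolding trig_coeff_def by (simp add: mult.commute)
  also have "\<dots> = (\<Sum>k\<in>I. if k = j then c j / trig_weight j else 0)"
    by (rule sum.cong) (auto simp: trig_coeff_def trig_orthogonal)
  finally show ?thesis using assms by simp
qed

text \<open>Completing the square in each coefficient. The last sum vanishes at the Fourier
  coefficients, which gives Bessel's inequality, and is nonnegative otherwise, which gives best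
  approximation.\<close>

lemma L2_dist_trig_sum:
  fixes c :: "int \<Rightarrow> real" and N :: nat
  assumes f: "L2_per f"
  defines "p \<equiv> \<lambda>x. \<Sum>k\<in>{- int N..int N}. c k * trig k x"
  shows "(LINT x|period_measure. (f x - p x)\<^sup>2) = (LINT x|period_measure. (f x)\<^sup>2) - trig_energy N f
     + (\<Sum>k\<in>{- int N..int N}. (c k - trig_weight k * trig_coeff k f)\<^sup>2 / trig_weight k)"
proof -
  let ?I = "{- int N..int N}"
  have p: "L2_per p" unfolding p_def by (rule L2_per_trig_sum) simp
  have fp: "(LINT x|period_measure. f x * p x) = (\<Sum>k\<in>?I. c k * trig_coeff k f)"
    unfolding p_def by (rule integral_trig_sum[OF f]) simp
  have pp: "(LINT x|period_measure. p x * p x) = (\<Sum>k\<in>?I. c k * (c k / trig_weight k))"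
  proof -
    have "(LINT x|period_measure. p x * p x) = (\<Sum>k\<in>?I. c k * trig_coeff k p)"
      using integral_trig_sum[OF p, of ?I c] by (simp add: p_def)
    also have "\<dots> = (\<Sum>k\<in>?I. c k * (c k / trig_weight k))"
      by (rule sum.cong) (simp_all add: p_def trig_coeff_trig_sum)
    finally show ?thesis .
  qed
  have "(LINT x|period_measure. (f x - p x)\<^sup>2)
      = (LINT x|period_measure. ((f x)\<^sup>2 - 2 * (f x * p x)) + p x * p x)"
    by (simp add: power2_eq_square algebra_simps)
  also have "\<dots> = (LINT x|period_measure. (f x)\<^sup>2) - 2 * (LINT x|period_measure. f x * p x)
      + (LINT x|period_measure. p x * p x)"
    using L2_per_square[OF f] L2_per_mult[OF f p] L2_per_mult[OF p p] by simp
  also have "\<dots> = (LINT x|period_measure. (f x)\<^sup>2) - trig_energy N f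
     + (\<Sum>k\<in>?I. trig_weight k * (trig_coeff k f)\<^sup>2 - 2 * (c k * trig_coeff k f) + c k * (c k / trig_weight k))"
    unfolding fp pp trig_energy_def sum.distrib sum_subtractf sum_distrib_left by simp
  also have "(\<Sum>k\<in>?I. trig_weight k * (trig_coeff k f)\<^sup>2 - 2 * (c k * trig_coeff k f) + c k * (c k / trig_weight k))
     = (\<Sum>k\<in>?I. (c k - trig_weight k * trig_coeff k f)\<^sup>2 / trig_weight k)"
    using trig_weight_pos
    by (intro sum.cong) (auto simp: power2_eq_square field_simps less_imp_neq[symmetric])
  finally show ?thesis .
qed

lemma trig_energy_le_dist:
  assumes "L2_per f"
  shows "(LINT x|period_measure. (f x)\<^sup>2) - trig_energy N f
    \<le> (LINT x|period_measure. (f x - (\<Sum>k\<in>{- int N..int N}. c k * trig k x))\<^sup>2)"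
  unfolding L2_dist_trig_sum[OF assms]
  using trig_weight_pos by (simp add: sum_nonneg less_imp_le)

lemma bessel:
  assumes "L2_per f"
  shows "trig_energy N f \<le> (LINT x|period_measure. (f x)\<^sup>2)"
proof -
  have "0 \<le> (LINT x|period_measure. (f x - (\<Sum>k\<in>{- int N..int N}. (trig_weight k * trig_coeff k f) * trig k x))\<^sup>2)"
    by (rule integral_nonneg_AE) simp
  then show ?thesis by (simp add: L2_dist_trig_sum[OF assms])
qed

lemma trig_energy_mono:
  assumes "M \<le> N"
  shows "trig_energy M f \<le> trig_energy N f"
  unfolding trig_energy_def
  by (intro sum_mono2) (use assms trig_weight_pos in \<open>auto simp: less_imp_le\<close>)

section \<open>The algebra of trigonometric polynomials\<close>

inductive trig_poly :: "(real \<Rightarrow> real) \<Rightarrow> bool" where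
  mode: "trig_poly (\<lambda>x. c * trig k x)"
| add: "trig_poly p \<Longrightarrow> trig_poly q \<Longrightarrow> trig_poly (\<lambda>x. p x + q x)"

lemma trig_poly_sum_form:
  assumes "trig_poly p"
  obtains N c where "p = (\<lambda>x. \<Sum>k\<in>{- int N..int N}. c k * trig k x)"
proof -
  have "\<exists>N c. p = (\<lambda>x. \<Sum>k\<in>{- int N..int N}. c k * trig k x)"
    using assms
  proof induction
    case (mode c k)
    show ?case
    proof (intro exI ext)
      fix x
      have "(\<Sum>j\<in>{- int (nat \<bar>k\<bar>)..int (nat \<bar>k\<bar>)}. (if j = k then c else 0) * trig j x)
        = (\<Sum>j\<in>{- int (nat \<bar>k\<bar>)..int (nat \<bar>k\<bar>)}. if j = k then c * trig k x else 0)"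
        by (rule sum.cong) auto
      then show "c * trig k x
        = (\<Sum>j\<in>{- int (nat \<bar>k\<bar>)..int (nat \<bar>k\<bar>)}. (if j = k then c else 0) * trig j x)"
        by auto
    qed
  next
    case (add p q)
    then obtain M c N d where p: "p = (\<lambda>x. \<Sum>k\<in>{- int M..int M}. c k * trig k x)"
      and q: "q = (\<lambda>x. \<Sum>k\<in>{- int N..int N}. d k * trig k x)"
      by blast
    \<comment> \<open>Padding the coefficients with zeros brings both sums to a common
      range.\<close>
    have widen: "(\<Sum>k\<in>{- int M..int M}. c k * trig k x)
      = (\<Sum>k\<in>{- int L..int L}. (if \<bar>k\<bar> \<le> int M then c k else 0) * trig k x)"
      if "M \<le> L" for M L c x
      by (rule sum.mono_neutral_cong_left) (use that in auto)
    let ?L = "max M N"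
    have "(\<lambda>x. p x + q x) = (\<lambda>x. \<Sum>k\<in>{- int ?L..int ?L}.
       ((if \<bar>k\<bar> \<le> int M then c k else 0) + (if \<bar>k\<bar> \<le> int N then d k else 0)) * trig k x)"
      unfolding p q distrib_right sum.distrib
      by (intro ext arg_cong2[where f="(+)"] widen) auto
    then show ?case by (intro exI)
  qed
  with that show ?thesis by blast
qed

lemma trig_poly_cmult:
  assumes "trig_poly p"
  shows "trig_poly (\<lambda>x. c * p x)"
  using assms
proof induction
  case (mode d k)
  then show ?case using trig_poly.mode[of "c * d" k] by (simp add: mult.assoc)
next
  case (add p q)
  then show ?case using trig_poly.add by (simp add: distrib_left)
qed

lemma trig_poly_cos: "trig_poly (\<lambda>x. cos (real_of_int k * x))"
  using trig_poly.mode[of 1 "\<bar>k\<bar>"] by (cases "k \<ge> 0") (simp_all add: trig_def)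

lemma trig_poly_sin: "trig_poly (\<lambda>x. sin (real_of_int k * x))"
proof -
  \<comment> \<open>Sines are stored at negative indices, so a positive frequency costs a sign; at
    \<open>k = 0\<close> the index names the constant mode and the coefficient is zero.\<close>
  have eq: "(\<lambda>x. sin (real_of_int k * x)) = (\<lambda>x. (if k = 0 then 0 else - sgn (real_of_int k)) * trig (- \<bar>k\<bar>) x)"
    by (auto simp: trig_def sgn_if)
  show ?thesis unfolding eq by (rule trig_poly.mode)
qed

lemma trig_poly_mult:
  assumes "trig_poly p" "trig_poly q"
  shows "trig_poly (\<lambda>x. p x * q x)"
proof -
  have half: "trig_poly (\<lambda>x. p x / 2 + q x / 2)" "trig_poly (\<lambda>x. p x / 2 - q x / 2)"
    if "trig_poly p" "trig_poly q" for p q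
    using trig_poly.add[OF trig_poly_cmult[OF that(1), of "1/2"] trig_poly_cmult[OF that(2), of "1/2"]]
      trig_poly.add[OF trig_poly_cmult[OF that(1), of "1/2"] trig_poly_cmult[OF that(2), of "-1/2"]]
    by simp_all
  have base: "trig_poly (\<lambda>x. trig j x * trig k x)" for j k
    unfolding trig_def
    by (cases "j \<ge> 0"; cases "k \<ge> 0")
      (auto simp: trig_mult simp del: of_int_add of_int_diff intro!: half trig_poly_cos trig_poly_sin)
  have modes: "trig_poly (\<lambda>x. (c * trig j x) * q x)" for c j
    using assms(2)
  proof induction
    case (mode d k)
    then show ?case using trig_poly_cmult[OF base[of j k], of "c * d"] by (simp add: mult_ac)
  next
    case (add p q)
    then show ?case using trig_poly.add by (simp add: distrib_left)
  qed
  from assms(1) show ?thesis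
  proof induction
    case (add p1 p2)
    then show ?case using trig_poly.add by (simp add: distrib_right)
  qed (rule modes)
qed

text \<open>Induction over the generators of real polynomial functions: a real-linear functional is
  determined by its values at 1 and \<open>\<i>\<close>, hence restricts to a combination of
  \<open>cos\<close> and \<open>sin\<close>, and products are covered by the product
  formulas.\<close>

lemma trig_poly_on_circle:
  fixes P :: "complex \<Rightarrow> real"
  assumes "real_polynomial_function P"
  shows "trig_poly (\<lambda>x. P (cis x))"
  using assms
proof induction
  case (linear f)
  then interpret bounded_linear f .
  have "(\<lambda>x. f (cis x)) = (\<lambda>x. f 1 * trig 1 x + (- f \<i>) * trig (- 1) x)"
  proof
    fix x
    have "f (cis x) = f (cos x *\<^sub>R 1 + sin x *\<^sub>R \<i>)"
      by (rule arg_cong[where f=f]) (simp add: complex_eq_iff)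
    then show "f (cis x) = f 1 * trig 1 x + (- f \<i>) * trig (- 1) x"
      by (simp add: add scaleR trig_def)
  qed
  then show ?case by (simp only: trig_poly.add trig_poly.mode)
next
  case (const c)
  show ?case using trig_poly.mode[of c 0] by (simp add: trig_def)
next
  case (add f g)
  then show ?case by (simp add: trig_poly.add)
next
  case (mult f g)
  then show ?case by (simp add: trig_poly_mult)
qed

section \<open>Density of trigonometric polynomials and Parseval's identity\<close>

lemma periodic_continuous_uniform_approx:
  fixes h :: "real \<Rightarrow> real"
  assumes cont: "continuous_on {0..2*pi} h" and per: "h 0 = h (2*pi)" and "e > 0"
  obtains p where "trig_poly p" "\<And>x. x \<in> {0..2*pi} \<Longrightarrow> \<bar>h x - p x\<bar> < e"
proof -
  define H where "H z = h (Arg2pi z)" for z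
  have H: "H (cis x) = h x" if "x \<in> {0..2*pi}" for x
  proof (cases "x = 2*pi")
    case True
    moreover have "Arg2pi 1 = 0" by (rule Arg2pi_unique[of 1]) auto
    ultimately show ?thesis using per by (simp add: H_def)
  next
    case False
    then have "Arg2pi (cis x) = x"
      using that by (intro Arg2pi_unique[of 1]) (auto simp: cis_conv_exp)
    then show ?thesis by (simp add: H_def)
  qed
  \<comment> \<open>\<open>Arg2pi\<close> jumps at 1, so \<open>H\<close> is not visibly a
    composition of continuous maps. Instead, the preimage of a closed set is the image under
    \<open>cis\<close> of a compact subset of the closed interval; equal endpoint values make
    \<open>H (cis x) = h x\<close> valid on all of it.\<close>
  have "continuous_on (sphere 0 1) H"
    unfolding continuous_on_closed_vimage[OF closed_sphere]
  proof (intro allI impI)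
    fix C :: "real set" assume "closed C"
    have "H -` C \<inter> sphere 0 1 = cis ` (h -` C \<inter> {0..2*pi})"
    proof (intro equalityI subsetI)
      fix z assume z: "z \<in> H -` C \<inter> sphere 0 1"
      let ?x = "Arg2pi z"
      have x: "?x \<in> {0..2*pi}" using Arg2pi[of z] by auto
      have zc: "z = cis ?x" using Arg2pi_eq[of z] z by (simp add: cis_conv_exp)
      then have "h ?x \<in> C" using z by (simp add: H_def)
      with zc x show "z \<in> cis ` (h -` C \<inter> {0..2*pi})" by blast
    qed (auto simp: H)
    moreover have "closed (h -` C \<inter> {0..2*pi})"
      using cont \<open>closed C\<close> by (simp add: continuous_on_closed_vimage)
    then have "compact (h -` C \<inter> {0..2*pi})"
      by (metis bounded_Int bounded_closed_interval compact_eq_bounded_closed inf_commute box_real(2) bounded_cbox)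
    then have "compact (cis ` (h -` C \<inter> {0..2*pi}))"
      by (intro compact_continuous_image continuous_intros)
    ultimately show "closed (H -` C \<inter> sphere 0 1)" by (simp add: compact_imp_closed)
  qed
  then obtain P where "real_polynomial_function P"
    and P: "\<And>z. z \<in> sphere 0 1 \<Longrightarrow> \<bar>H z - P z\<bar> < e"
    using Stone_Weierstrass_real_polynomial_function[OF compact_sphere _ \<open>e > 0\<close>] by blast
  then have "trig_poly (\<lambda>x. P (cis x))" by (intro trig_poly_on_circle)
  moreover have "\<bar>h x - P (cis x)\<bar> < e" if "x \<in> {0..2*pi}" for x
    using P[of "cis x"] H[OF that] by simp
  ultimately show ?thesis using that by blast
qed

lemma trig_poly_L2: "trig_poly p \<Longrightarrow> L2_per p"
  by (elim trig_poly_sum_form) (simp add: L2_per_trig_sum)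

lemma periodic_continuous_L2_approx:
  fixes h :: "real \<Rightarrow> real"
  assumes cont: "continuous_on UNIV h" and per: "h 0 = h (2*pi)" and "e > 0"
  obtains p where "trig_poly p" "(LINT x|period_measure. (h x - p x)\<^sup>2) < e"
proof -
  \<comment> \<open>A uniform error \<open>d\<close> on an interval of length \<open>2 * pi\<close>
    contributes at most \<open>2 * pi * d\<^sup>2 = e / 2\<close>.\<close>
  define d where "d = sqrt (e / (4 * pi))"
  have d: "d > 0" "d\<^sup>2 = e / (4 * pi)" using \<open>e > 0\<close> by (auto simp: d_def)
  obtain p where p: "trig_poly p" "\<And>x. x \<in> {0..2*pi} \<Longrightarrow> \<bar>h x - p x\<bar> < d"
    using periodic_continuous_uniform_approx[OF continuous_on_subset[OF cont] per d(1)] by auto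
  have "(LINT x|period_measure. (h x - p x)\<^sup>2) \<le> (LINT x|period_measure. d\<^sup>2)"
  proof (rule integral_mono)
    show "integrable period_measure (\<lambda>x. (h x - p x)\<^sup>2)"
      by (intro L2_per_square L2_per_diff L2_per_continuous cont trig_poly_L2 p)
    show "(h x - p x)\<^sup>2 \<le> d\<^sup>2" if "x \<in> space period_measure" for x
      using p(2)[of x] that power_mono[of "\<bar>h x - p x\<bar>" d 2] by simp
  qed simp
  also have "\<dots> = d\<^sup>2 * (2 * pi)"
    by (simp add: period_measure_def measure_restrict_space space_restrict_space)
  also have "\<dots> < e" using \<open>e > 0\<close> by (simp add: d)
  finally show ?thesis using that p(1) by blast
qed

text \<open>The continuous functions come from \<open>measurable_on\<close>, the a.e. limits of continuous
  functions; the cutoff \<open>cut\<close> makes them vanish at both endpoints, hence periodic.\<close>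
lemma bounded_L2_approx:
  fixes f :: "real \<Rightarrow> real"
  assumes meas: "f \<in> borel_measurable period_measure" and bd: "\<And>x. \<bar>f x\<bar> \<le> B" and "e > 0"
  obtains h where "continuous_on UNIV h" "h 0 = h (2*pi)" "(LINT x|period_measure. (f x - h x)\<^sup>2) < e"
proof -
  have B: "B \<ge> 0" using bd[of 0] by linarith
  have "(\<lambda>x. indicator {0..2*pi} x *\<^sub>R f x) \<in> borel_measurable lborel"
    using meas borel_measurable_restrict_space_iff[OF period_lborel_Int, of f]
    by (simp add: period_measure_def)
  then have "(\<lambda>x. indicator {0..2*pi} x *\<^sub>R f x) \<in> borel_measurable lebesgue"
    using measurable_completion by blast
  then have "(\<lambda>x. indicator {0..2*pi} x *\<^sub>R f x) measurable_on UNIV"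
    by (intro lebesgue_measurable_imp_measurable_on_real) auto
  then obtain N g where N: "negligible N" and g: "\<And>n. continuous_on UNIV (g n)"
    and lim: "\<And>x. x \<notin> N \<Longrightarrow> (\<lambda>n. g n x) \<longlonglongrightarrow> indicator {0..2*pi} x *\<^sub>R f x"
    unfolding measurable_on_def by auto
  define cut where "cut n x = min 1 (real n * max 0 (min x (2*pi - x)))" for n :: nat and x :: real
  \<comment> \<open>Clipping at \<open>B\<close> leaves the limit unchanged, since \<open>f\<close>
    obeys the same bound, and supplies a constant dominating function.\<close>
  define h where "h n x = max (- B) (min B (g n x)) * cut n x" for n x
  have cut01: "0 \<le> cut n x" "cut n x \<le> 1" for n x by (auto simp: cut_def)
  have hc: "continuous_on UNIV (h n)" for n
    unfolding h_def cut_def by (intro continuous_intros g)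
  have hB: "\<bar>h n x\<bar> \<le> B" for n x
  proof -
    have "\<bar>h n x\<bar> \<le> B * 1"
      unfolding h_def abs_mult by (rule mult_mono) (use cut01[of n x] B in auto)
    then show ?thesis by simp
  qed
  have h_lim: "(\<lambda>n. h n x) \<longlonglongrightarrow> f x" if "x \<notin> N" "0 < x" "x < 2*pi" for x
  proof -
    have "(\<lambda>n. max (- B) (min B (g n x))) \<longlonglongrightarrow> max (- B) (min B (f x))"
      using lim[OF that(1)] that by (intro tendsto_intros) auto
    moreover have "max (- B) (min B (f x)) = f x" using bd[of x] by auto
    moreover have "(\<lambda>n. cut n x) \<longlonglongrightarrow> 1"
    proof (rule tendsto_eventually)
      define m where "m = min x (2*pi - x)"
      have "m > 0" using that by (simp add: m_def)
      have "eventually (\<lambda>n. real n \<ge> 1 / m) sequentially" by (intro filterlim_at_top[THEN iffD1, rule_format, OF filterlim_real_sequentially])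
      then show "eventually (\<lambda>n. cut n x = 1) sequentially"
      proof eventually_elim
        case (elim n)
        then have "1 \<le> real n * max 0 m" using \<open>m > 0\<close> by (simp add: field_simps)
        then show ?case by (simp add: cut_def m_def)
      qed
    qed
    ultimately show ?thesis unfolding h_def using tendsto_mult by fastforce
  qed
  have "(\<lambda>n. LINT x|period_measure. (f x - h n x)\<^sup>2) \<longlonglongrightarrow> (LINT x|period_measure. 0)"
  proof (rule integral_dominated_convergence[where w="\<lambda>_. (2 * B)\<^sup>2"])
    show "(\<lambda>x. (f x - h n x)\<^sup>2) \<in> borel_measurable period_measure" for n
      by (intro borel_measurable_power borel_measurable_diff meas continuous_on_measurable_period hc)
    show "AE x in period_measure. norm ((f x - h n x)\<^sup>2) \<le> (2 * B)\<^sup>2" for n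
    proof (rule AE_I2)
      fix x
      have "\<bar>f x - h n x\<bar> \<le> 2 * B" using bd[of x] hB[of n x] by linarith
      then show "norm ((f x - h n x)\<^sup>2) \<le> (2 * B)\<^sup>2"
        using power_mono[of "\<bar>f x - h n x\<bar>" "2 * B" 2] by simp
    qed
    have "AE x in lebesgue. x \<notin> N"
      using N by (simp add: negligible_iff_null_sets AE_not_in)
    then have "AE x in lborel. x \<notin> N"
      by (simp add: AE_completion_iff)
    \<comment> \<open>At the endpoints \<open>h n\<close> is zero whatever the value of
      \<open>f\<close>, so these two points join the exceptional set.\<close>
    moreover have "AE x in lborel. x \<noteq> 0" "AE x in lborel. x \<noteq> 2*pi"
      by (rule AE_lborel_singleton)+
    ultimately show "AE x in period_measure. (\<lambda>n. (f x - h n x)\<^sup>2) \<longlonglongrightarrow> 0"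
      unfolding AE_period_iff
    proof eventually_elim
      case (elim x)
      show ?case
      proof
        assume "x \<in> {0..2*pi}"
        then have "(\<lambda>n. h n x) \<longlonglongrightarrow> f x" using elim by (intro h_lim) auto
        then have "(\<lambda>n. (f x - h n x)\<^sup>2) \<longlonglongrightarrow> (f x - f x)\<^sup>2" by (intro tendsto_intros)
        then show "(\<lambda>n. (f x - h n x)\<^sup>2) \<longlonglongrightarrow> 0" by simp
      qed
    qed
  qed auto
  then have "eventually (\<lambda>n. (LINT x|period_measure. (f x - h n x)\<^sup>2) < e) sequentially"
    using \<open>e > 0\<close> by (intro order_tendstoD(2)) auto
  then obtain n where "(LINT x|period_measure. (f x - h n x)\<^sup>2) < e"
    by (auto simp: eventually_sequentially)
  moreover have "h n 0 = h n (2*pi)" by (simp add: h_def cut_def)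
  ultimately show ?thesis using that hc by blast
qed

lemma L2_bounded_approx:
  assumes f: "L2_per f" and "e > 0"
  obtains g B where "g \<in> borel_measurable period_measure" "\<And>x. \<bar>g x\<bar> \<le> B"
    "(LINT x|period_measure. (f x - g x)\<^sup>2) < e"
proof -
  define g where "g n x = max (- real n) (min (real n) (f x))" for n x
  have m: "g n \<in> borel_measurable period_measure" for n
    unfolding g_def using L2_per_measurable[OF f]
    by (intro borel_measurable_max borel_measurable_min) auto
  have "(\<lambda>n. LINT x|period_measure. (f x - g n x)\<^sup>2) \<longlonglongrightarrow> (LINT x|period_measure. 0)"
  proof (rule integral_dominated_convergence[where w="\<lambda>x. (f x)\<^sup>2"])
    show "(\<lambda>x. (f x - g n x)\<^sup>2) \<in> borel_measurable period_measure" for n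
      by (intro borel_measurable_power borel_measurable_diff m L2_per_measurable f)
    show "AE x in period_measure. norm ((f x - g n x)\<^sup>2) \<le> (f x)\<^sup>2" for n
    proof (rule AE_I2)
      fix x
      have "\<bar>f x - g n x\<bar> \<le> \<bar>f x\<bar>" by (auto simp: g_def)
      then show "norm ((f x - g n x)\<^sup>2) \<le> (f x)\<^sup>2"
        by (simp add: abs_le_square_iff)
    qed
    show "AE x in period_measure. (\<lambda>n. (f x - g n x)\<^sup>2) \<longlonglongrightarrow> 0"
    proof (intro AE_I2 tendsto_eventually)
      fix x
      have "eventually (\<lambda>n. real n \<ge> \<bar>f x\<bar>) sequentially" by (intro filterlim_at_top[THEN iffD1, rule_format, OF filterlim_real_sequentially])
      then show "eventually (\<lambda>n. (f x - g n x)\<^sup>2 = 0) sequentially"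
        by eventually_elim (auto simp: g_def)
    qed
  qed (use L2_per_square[OF f] in auto)
  then have "eventually (\<lambda>n. (LINT x|period_measure. (f x - g n x)\<^sup>2) < e) sequentially"
    using \<open>e > 0\<close> by (intro order_tendstoD(2)) auto
  then obtain n where "(LINT x|period_measure. (f x - g n x)\<^sup>2) < e"
    by (auto simp: eventually_sequentially)
  moreover have "\<bar>g n x\<bar> \<le> real n" for x by (auto simp: g_def)
  ultimately show ?thesis using that m by blast
qed

lemma trig_poly_dense:
  assumes f: "L2_per f" and "e > 0"
  obtains p where "trig_poly p" "(LINT x|period_measure. (f x - p x)\<^sup>2) < e"
proof -
  \<comment> \<open>Two uses of the squared triangle inequality weight the three errors by 2, 4 and
    4, for a total below \<open>10 * e / 16\<close>.\<close>
  have e: "e / 16 > 0" using \<open>e > 0\<close> by simp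
  obtain g B where g: "g \<in> borel_measurable period_measure" "\<And>x. \<bar>g x\<bar> \<le> B"
    "(LINT x|period_measure. (f x - g x)\<^sup>2) < e / 16"
    using L2_bounded_approx[OF f e] by blast
  obtain h where h: "continuous_on UNIV h" "h 0 = h (2*pi)" "(LINT x|period_measure. (g x - h x)\<^sup>2) < e / 16"
    using bounded_L2_approx[OF g(1,2) e] by blast
  obtain p where p: "trig_poly p" "(LINT x|period_measure. (h x - p x)\<^sup>2) < e / 16"
    using periodic_continuous_L2_approx[OF h(1,2) e] by blast
  note L2 = f L2_per_bounded[OF g(1,2)] L2_per_continuous[OF h(1)] trig_poly_L2[OF p(1)]
  have "(LINT x|period_measure. (f x - p x)\<^sup>2) < e"
    using L2_dist_triangle[OF L2(1,2,4)] L2_dist_triangle[OF L2(2,3,4)] g(3) h(3) p(2) \<open>e > 0\<close> by linarith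
  with p(1) show ?thesis using that by blast
qed

text \<open>The partial energies increase and are bounded by Bessel's inequality; best approximation
  turns a trigonometric polynomial close to \<open>f\<close> into a partial energy close to the
  bound.\<close>

lemma parseval:
  assumes f: "L2_per f"
  shows "(\<lambda>N. trig_energy N f) \<longlonglongrightarrow> (LINT x|period_measure. (f x)\<^sup>2)"
proof (rule increasing_LIMSEQ)
  show "trig_energy N f \<le> trig_energy (Suc N) f" for N
    by (rule trig_energy_mono) simp
  show "trig_energy N f \<le> (LINT x|period_measure. (f x)\<^sup>2)" for N
    by (rule bessel[OF f])
  fix e :: real assume "e > 0"
  then obtain p where p: "trig_poly p" "(LINT x|period_measure. (f x - p x)\<^sup>2) < e"
    using trig_poly_dense[OF f] by blast
  from p(1) obtain N c where "p = (\<lambda>x. \<Sum>k\<in>{- int N..int N}. c k * trig k x)"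
    by (rule trig_poly_sum_form)
  with p(2) trig_energy_le_dist[OF f, of N c]
  show "\<exists>N. (LINT x|period_measure. (f x)\<^sup>2) \<le> trig_energy N f + e"
    by (intro exI[of _ N]) simp
qed

section \<open>Decay of a single Fourier mode\<close>

text \<open>The product \<open>exp (a * t) * E t\<close> is nonincreasing. At time 0 only a
  one-sided derivative is available, so monotonicity uses derivatives in the open interval and
  continuity up to its ends.\<close>

lemma gronwall_decay:
  fixes E E' :: "real \<Rightarrow> real"
  assumes "\<And>t. t \<ge> 0 \<Longrightarrow> (E has_real_derivative E' t) (at t within {0..})"
    and "\<And>t. t \<ge> 0 \<Longrightarrow> E' t \<le> - (a * E t)"
    and "t \<ge> 0"
  shows "E t \<le> exp (- a * t) * E 0"
proof -
  define G where "G t = exp (a * t) * E t" for t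
  have d: "(G has_real_derivative exp (a * s) * (a * E s + E' s)) (at s within {0..})"
    if "s \<ge> 0" for s
    unfolding G_def using that
    by (auto intro!: derivative_eq_intros assms(1) simp: algebra_simps)
  have "G t \<le> G 0"
  proof (rule DERIV_nonpos_imp_decreasing_open[OF \<open>t \<ge> 0\<close>])
    fix s assume s: "0 < s" "s < t"
    then have "at s within {0..} = at s"
      by (intro at_within_interior) simp
    then have "DERIV G s :> exp (a * s) * (a * E s + E' s)"
      using d[of s] s by simp
    moreover have "exp (a * s) * (a * E s + E' s) \<le> 0"
      using assms(2)[of s] s by (auto simp: mult_le_0_iff)
    ultimately show "\<exists>y. DERIV G s :> y \<and> y \<le> 0" by blast
  next
    have "continuous_on {0..} G"
      by (rule DERIV_continuous_on[OF d]) simp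
    then show "continuous_on {0..t} G" by (rule continuous_on_subset) auto
  qed
  then have "exp (- a * t) * (exp (a * t) * E t) \<le> exp (- a * t) * E 0"
    by (intro mult_left_mono) (auto simp: G_def)
  then show ?thesis by (simp add: exp_minus field_simps)
qed

text \<open>The rate of the mode with coupling \<open>\<kappa>\<close> comes from the eigenvalues
  \<open>-1/2 \<plusminus> sqrt (1/4 - \<kappa>\<^sup>2)\<close>; the cross term of the Lyapunov function is the one that makes the
  functional decay at exactly this rate.\<close>
lemma mode_decay:
  fixes y z :: "real \<Rightarrow> real"
  assumes y: "\<And>t. t \<ge> 0 \<Longrightarrow> (y has_real_derivative - \<kappa> * z t) (at t within {0..})"
    and z: "\<And>t. t \<ge> 0 \<Longrightarrow> (z has_real_derivative \<kappa> * y t - z t) (at t within {0..})"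
    and \<kappa>: "\<kappa> > 0" "\<kappa> < 1/2 \<Longrightarrow> 2 * \<kappa> \<le> \<Theta>" "\<kappa> \<ge> 1/2 \<Longrightarrow> 1 / (2 * \<kappa>) \<le> \<Theta>"
    and \<Theta>: "\<Theta> < 1"
    and lam: "0 \<le> lam" "lam \<le> 1/2" "lam * (1 - lam) \<le> \<kappa>\<^sup>2"
    and t: "t \<ge> 0"
  shows "(y t)\<^sup>2 + (z t)\<^sup>2 \<le> (1 + \<Theta>) / (1 - \<Theta>) * exp (- (2 * lam) * t) * ((y 0)\<^sup>2 + (z 0)\<^sup>2)"
proof -
  define \<theta> where "\<theta> = (if \<kappa> < 1/2 then 2 * \<kappa> else 1 / (2 * \<kappa>))"
  define E where "E t = (y t)\<^sup>2 + (z t)\<^sup>2 - 2 * \<theta> * (y t * z t)" for t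
  have \<theta>: "0 \<le> \<theta>" "\<theta> \<le> \<Theta>"
    using \<kappa> by (auto simp: \<theta>_def)
  have yz: "\<bar>2 * \<theta> * (y t * z t)\<bar> \<le> \<Theta> * ((y t)\<^sup>2 + (z t)\<^sup>2)" for t
  proof -
    have "\<bar>2 * (y t * z t)\<bar> \<le> (y t)\<^sup>2 + (z t)\<^sup>2"
      using sum_squares_bound[of "y t" "z t"] sum_squares_bound[of "y t" "- z t"]
      by (simp add: abs_le_iff algebra_simps)
    then have "\<theta> * \<bar>2 * (y t * z t)\<bar> \<le> \<Theta> * ((y t)\<^sup>2 + (z t)\<^sup>2)"
      by (intro mult_mono) (use \<theta> in auto)
    then show ?thesis using \<theta> by (simp add: abs_mult mult_ac)
  qed
  have lower: "(1 - \<Theta>) * ((y t)\<^sup>2 + (z t)\<^sup>2) \<le> E t" for t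
    using yz[of t] by (simp add: E_def algebra_simps abs_le_iff)
  have upper: "E t \<le> (1 + \<Theta>) * ((y t)\<^sup>2 + (z t)\<^sup>2)" for t
    using yz[of t] by (simp add: E_def algebra_simps abs_le_iff)
  have E0: "E t \<ge> 0" for t
    using lower[of t] \<Theta> by (smt (verit) mult_nonneg_nonneg zero_le_power2)
  define E' where "E' t = 2 * y t * (- \<kappa> * z t) + 2 * z t * (\<kappa> * y t - z t)
      - 2 * \<theta> * (y t * (\<kappa> * y t - z t) + (- \<kappa> * z t) * z t)" for t
  have dE: "(E has_real_derivative E' t) (at t within {0..})" if "t \<ge> 0" for t
    unfolding E_def E'_def using that
    by (auto intro!: derivative_eq_intros y z simp: algebra_simps)
  have bound: "E' t \<le> - ((2 * lam) * E t)" for t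
  proof (cases "\<kappa> < 1/2")
    case False
    \<comment> \<open>Here \<kappa> = 1/2 is excluded by \<Theta> < 1, so the eigenvalues are
      complex conjugate with real part -1/2, and \<open>E\<close> satisfies an exact linear
      equation.\<close>
    then have "2 * \<theta> * \<kappa> = 1" using \<kappa> by (simp add: \<theta>_def)
    then have "E' t = - E t"
      unfolding E'_def E_def power2_eq_square by algebra
    moreover have "2 * lam * E t \<le> 1 * E t"
      using lam E0[of t] by (intro mult_right_mono) auto
    ultimately show ?thesis by simp
  next
    case True
    \<comment> \<open>\<open>- m\<close> is the eigenvalue closer to zero, which governs the decay
      of this mode.\<close>
    define m where "m = 1/2 - sqrt (1/4 - \<kappa>\<^sup>2)"
    have k4: "\<kappa>\<^sup>2 \<le> 1/4" using power_mono[of \<kappa> "1/2" 2] True \<kappa> by (simp add: power_divide)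
    have m: "m * (1 - m) = \<kappa>\<^sup>2"
      using k4 using real_sqrt_pow2[of "1/4 - \<kappa>\<^sup>2"] k4 by (simp add: m_def algebra_simps power2_eq_square)
    have m2: "m \<le> 1/2" using k4 by (simp add: m_def)
    have m0: "0 \<le> m"
    proof -
      have "sqrt (1/4 - \<kappa>\<^sup>2) \<le> 1/2"
        by (rule real_le_lsqrt) (use k4 in \<open>auto simp: power_divide\<close>)
      then show ?thesis by (simp add: m_def)
    qed
    have "lam \<le> m"
    proof (rule ccontr)
      assume "\<not> lam \<le> m"
      \<comment> \<open>The product equals \<open>lam * (1 - lam) - m * (1 - m)\<close>: the map
        \<open>x * (1 - x)\<close> increases up to 1/2.\<close>
      then have "(lam - m) * (1 - lam - m) > 0"
        using lam m2 by (intro mult_pos_pos) auto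
      then show False using m lam by (simp add: algebra_simps)
    qed
    have "\<kappa> = sqrt m * sqrt (1 - m)"
      using m \<kappa> by (metis real_sqrt_mult real_sqrt_abs abs_of_pos)
    then have sq: "(sqrt m * y t - sqrt (1 - m) * z t)\<^sup>2
        = m * (y t)\<^sup>2 + (1 - m) * (z t)\<^sup>2 - 2 * \<kappa> * (y t * z t)"
      using m0 m2 by (simp add: power2_diff power_mult_distrib)
    have "\<theta> = 2 * \<kappa>" using True by (simp add: \<theta>_def)
    \<comment> \<open>The defect is a nonpositive multiple of the square \<open>sq\<close>, which
      vanishes exactly along the slow eigenvector; there \<open>E\<close> decays at rate
      \<open>2 * m\<close> and no faster.\<close>
    then have "E' t + 2 * m * E t
        = - (2 * (1 - 2 * m)) * (m * (y t)\<^sup>2 + (1 - m) * (z t)\<^sup>2 - 2 * \<kappa> * (y t * z t))"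
      using m[symmetric] unfolding E'_def E_def power2_eq_square by algebra
    also have "\<dots> \<le> 0"
      unfolding sq[symmetric] using m2 by (auto simp: mult_le_0_iff)
    finally have "E' t \<le> - (2 * m * E t)" by simp
    moreover have "2 * lam * E t \<le> 2 * m * E t"
      using \<open>lam \<le> m\<close> E0[of t] by (intro mult_right_mono) auto
    ultimately show ?thesis by simp
  qed
  have "(1 - \<Theta>) * ((y t)\<^sup>2 + (z t)\<^sup>2) \<le> E t" by (rule lower)
  also have "E t \<le> exp (- (2 * lam) * t) * E 0"
    by (rule gronwall_decay[OF dE bound t])
  also have "\<dots> \<le> exp (- (2 * lam) * t) * ((1 + \<Theta>) * ((y 0)\<^sup>2 + (z 0)\<^sup>2))"
    by (intro mult_left_mono upper) simp
  finally show ?thesis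
    using \<Theta> by (simp add: field_simps)
qed

section \<open>Uniformity over the modes and the decay rate\<close>

text \<open>Below the critical frequency \<open>1 / (2 * \<sigma>)\<close> the cross coefficient
  increases with \<open>k\<close>, above it decreases. The extreme modes are thus the two integers
  enclosing the critical frequency, and non-integrality keeps both values strictly below 1.\<close>

lemma spectral_gap_uniform:
  fixes \<sigma> :: real
  assumes \<sigma>: "\<sigma> > 0" "1 / (2 * \<sigma>) \<notin> \<nat>"
  obtains \<Theta> where "0 < \<Theta>" "\<Theta> < 1"
    "\<And>k. (0::int) < k \<Longrightarrow> \<sigma> * k < 1/2 \<Longrightarrow> 2 * (\<sigma> * k) \<le> \<Theta>"
    "\<And>k. (0::int) < k \<Longrightarrow> \<sigma> * k \<ge> 1/2 \<Longrightarrow> 1 / (2 * (\<sigma> * k)) \<le> \<Theta>"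
proof -
  define m where "m = \<lfloor>1 / (2 * \<sigma>)\<rfloor>"
  have m0: "0 \<le> m" using \<sigma> by (simp add: m_def)
  have "real_of_int m \<noteq> 1 / (2 * \<sigma>)"
    using \<sigma>(2) m0 by (metis of_nat_in_Nats of_int_of_nat_eq zero_le_imp_eq_int)
  then have m1: "real_of_int m < 1 / (2 * \<sigma>)"
    unfolding m_def by (meson of_int_floor_le order_less_le)
  have m2: "1 / (2 * \<sigma>) < real_of_int m + 1" unfolding m_def by linarith
  let ?T = "max (2 * (\<sigma> * m)) (1 / (2 * (\<sigma> * (m + 1))))"
  have p: "0 < \<sigma> * (real_of_int m + 1)" using \<sigma> m0 by simp
  \<comment> \<open>The first entry is zero when \<open>m = 0\<close>; positivity comes from the
    second.\<close>
  have T0: "0 < ?T" using p by (simp add: less_max_iff_disj)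
  have T1: "?T < 1" using m1 m2 \<sigma> p by (simp add: field_simps)
  have Ta: "2 * (\<sigma> * k) \<le> ?T" if "k > 0" "\<sigma> * k < 1/2" for k :: int
  proof -
    have "real_of_int k < 1 / (2 * \<sigma>)" using that \<sigma> by (simp add: field_simps)
    then have "k \<le> m" unfolding m_def by linarith
    then have "2 * (\<sigma> * k) \<le> 2 * (\<sigma> * m)" using \<sigma> by simp
    then show ?thesis by simp
  qed
  have Tb: "1 / (2 * (\<sigma> * k)) \<le> ?T" if "k > 0" "\<sigma> * k \<ge> 1/2" for k :: int
  proof -
    have "real_of_int k \<ge> 1 / (2 * \<sigma>)" using that \<sigma> by (simp add: field_simps)
    then have "m + 1 \<le> k" using m1 by linarith
    then have "real_of_int (m + 1) \<le> real_of_int k" by (rule of_int_le_iff[THEN iffD2])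
    then have "1 / (2 * (\<sigma> * k)) \<le> 1 / (2 * (\<sigma> * (m + 1)))"
      using \<sigma> m0 that(1) by (intro divide_left_mono mult_left_mono mult_pos_pos) auto
    then show ?thesis by simp
  qed
  show ?thesis by (rule that[OF T0 T1 Ta Tb])
qed

text \<open>For \<sigma> > 1/2 the complex root is purely imaginary, so its real part is the root of
  the positive part and the rate saturates at 1/2. The last inequality is the form in which rates of
  different modes are compared.\<close>

lemma decay_rate:
  fixes \<sigma> :: real
  assumes "\<sigma> > 0"
  defines "lam \<equiv> Re (1/2 - csqrt (complex_of_real (1/4 - \<sigma>\<^sup>2)))"
  shows "0 \<le> lam" "lam \<le> 1/2" "lam * (1 - lam) \<le> \<sigma>\<^sup>2"
proof -
  define s where "s = sqrt (max 0 (1/4 - \<sigma>\<^sup>2))"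
  have lam: "lam = 1/2 - s"
    unfolding lam_def s_def csqrt_of_real' by (auto simp: max_def)
  have "s \<le> 1/2" unfolding s_def
    by (rule real_le_lsqrt) (auto simp: power_divide max_def)
  then show "0 \<le> lam" by (simp add: lam)
  show "lam \<le> 1/2" by (simp add: lam s_def)
  have "s\<^sup>2 = max 0 (1/4 - \<sigma>\<^sup>2)" by (simp add: s_def)
  then show "lam * (1 - lam) \<le> \<sigma>\<^sup>2" by (auto simp: lam algebra_simps power2_eq_square max_def)
qed

section \<open>Fourier coefficients of a solution\<close>

lemma DERIV_trig: "(trig k has_real_derivative real_of_int k * trig (- k) x) (at x)"
proof (cases "k \<ge> 0")
  case True
  then have eq: "trig k = (\<lambda>x. cos (real_of_int k * x))" by (simp add: fun_eq_iff trig_def)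
  have "(trig k has_real_derivative - sin (real_of_int k * x) * real_of_int k) (at x)"
    unfolding eq by (auto intro!: derivative_eq_intros)
  moreover have "- sin (real_of_int k * x) * real_of_int k = real_of_int k * trig (- k) x"
    using True by (cases "k = 0") (auto simp: trig_def)
  ultimately show ?thesis by (simp only:)
next
  case False
  then have eq: "trig k = (\<lambda>x. sin (real_of_int k * x))" by (simp add: fun_eq_iff trig_def)
  have "(trig k has_real_derivative cos (real_of_int k * x) * real_of_int k) (at x)"
    unfolding eq by (auto intro!: derivative_eq_intros)
  moreover have "cos (real_of_int k * x) * real_of_int k = real_of_int k * trig (- k) x"
    using False by (simp add: trig_def)
  ultimately show ?thesis by (simp only:)
qed

lemma deriv_trig: "deriv (trig k) = (\<lambda>x. real_of_int k * trig (- k) x)"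
  by (rule ext, rule DERIV_imp_deriv, rule DERIV_trig)

text \<open>This admits the modes as test functions in the weak formulation. Iterated derivatives
  remain multiples of a single mode.\<close>

lemma smooth_periodic_trig: "smooth_periodic (trig k)"
  unfolding smooth_periodic_def
proof (intro conjI allI)
  fix n
  have "\<exists>c j. (deriv ^^ n) (trig k) = (\<lambda>x. c * trig j x)"
  proof (induction n)
    case 0
    show ?case by (intro exI[of _ 1] exI[of _ k]) simp
  next
    case (Suc n)
    then obtain c j where cj: "(deriv ^^ n) (trig k) = (\<lambda>x. c * trig j x)" by blast
    have "deriv (\<lambda>x. c * trig j x) = (\<lambda>x. (c * real_of_int j) * trig (- j) x)"
      by (intro ext DERIV_imp_deriv, unfold mult.assoc) (rule DERIV_cmult[OF DERIV_trig])
    then show ?case using cj by auto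
  qed
  then obtain c j where cj: "(deriv ^^ n) (trig k) = (\<lambda>x. c * trig j x)" by blast
  have "(\<lambda>x. c * trig j x) differentiable at x" for x
    using DERIV_cmult[OF DERIV_trig, of c j x] real_differentiable_def by blast
  then show "(deriv ^^ n) (trig k) differentiable_on UNIV"
    unfolding cj by (simp add: differentiable_on_def)
next
  fix x
  have "cos (real_of_int k * (x + 2*pi)) = cos (real_of_int k * x)"
    using cos_int_2pin[of k] sin_int_2pin[of k]
    by (simp add: distrib_left cos_add mult.commute[of "real_of_int k" "2*pi"])
  moreover have "sin (real_of_int k * (x + 2*pi)) = sin (real_of_int k * x)"
    using cos_int_2pin[of k] sin_int_2pin[of k]
    by (simp add: distrib_left sin_add mult.commute[of "real_of_int k" "2*pi"])
  ultimately show "trig k (x + 2*pi) = trig k x"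
    by (simp add: trig_def)
qed

lemma trig_coeff_diff_const:
  assumes "L2_per f"
  shows "trig_coeff k (\<lambda>x. f x - c) = trig_coeff k f - (if k = 0 then 2 * pi * c else 0)"
proof -
  have "(LINT x|period_measure. trig 0 x * trig k x) = (if k = 0 then 2 * pi else 0)"
    unfolding trig_orthogonal by (auto simp: trig_weight_def)
  then have "(LINT x|period_measure. trig k x) = (if k = 0 then 2 * pi else 0)"
    by (simp add: trig_def)
  then show ?thesis
    unfolding trig_coeff_def left_diff_distrib
    using L2_per_mult[OF assms L2_per_trig, of k] L2_per_integrable[OF L2_per_trig, of k]
    by simp
qed

lemma solution_L2:
  assumes "two_velocity_solution \<sigma> fIp fIm fp fm" "t \<ge> 0"
  shows "L2_per (\<lambda>x. fp x t)" "L2_per (\<lambda>x. fm x t)"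
  using assms unfolding two_velocity_solution_def by auto

text \<open>Testing with mode \<open>k\<close> puts the space derivative on the test function, so
  transport couples \<open>k\<close> to \<open>- k\<close> while the exchange term stays at
  \<open>k\<close>.\<close>

lemma solution_trig_coeff_deriv:
  assumes sol: "two_velocity_solution \<sigma> fIp fIm fp fm" and t: "t \<ge> 0"
  defines "P \<equiv> \<lambda>k t. trig_coeff k (\<lambda>x. fp x t)"
    and "M \<equiv> \<lambda>k t. trig_coeff k (\<lambda>x. fm x t)"
  shows "(P k has_real_derivative \<sigma> * k * P (- k) t + (M k t - P k t) / 2) (at t within {0..})"
    and "(M k has_real_derivative - (\<sigma> * k * M (- k) t) - (M k t - P k t) / 2) (at t within {0..})"
proof -
  note L2 = solution_L2[OF sol t]
  note i = L2[THEN L2_per_mult[OF _ L2_per_trig]]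
  have weak: "((\<lambda>s. LINT x|period_measure. fp x s * trig k x) has_real_derivative
       (LINT x|period_measure. \<sigma> * fp x t * deriv (trig k) x + (1/2) * (fm x t - fp x t) * trig k x))
     (at t within {0..})"
    "((\<lambda>s. LINT x|period_measure. fm x s * trig k x) has_real_derivative
       (LINT x|period_measure. - \<sigma> * fm x t * deriv (trig k) x - (1/2) * (fm x t - fp x t) * trig k x))
     (at t within {0..})"
    using sol smooth_periodic_trig[of k] t
    unfolding two_velocity_solution_def set_integral_period by blast+
  have "(LINT x|period_measure. \<sigma> * fp x t * deriv (trig k) x + (1/2) * (fm x t - fp x t) * trig k x)
    = (LINT x|period_measure. \<sigma> * k * (fp x t * trig (- k) x)
        + ((1/2) * (fm x t * trig k x) - (1/2) * (fp x t * trig k x)))"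
    by (simp add: deriv_trig algebra_simps diff_divide_distrib)
  also have "\<dots> = \<sigma> * k * P (- k) t + (M k t - P k t) / 2"
    unfolding P_def M_def trig_coeff_def using i by (simp add: diff_divide_distrib)
  finally show "(P k has_real_derivative \<sigma> * k * P (- k) t + (M k t - P k t) / 2) (at t within {0..})"
    using weak(1) unfolding P_def trig_coeff_def by simp
  have "(LINT x|period_measure. - \<sigma> * fm x t * deriv (trig k) x - (1/2) * (fm x t - fp x t) * trig k x)
    = (LINT x|period_measure. - (\<sigma> * k) * (fm x t * trig (- k) x)
        - ((1/2) * (fm x t * trig k x) - (1/2) * (fp x t * trig k x)))"
    by (simp add: deriv_trig algebra_simps diff_divide_distrib)
  also have "\<dots> = - (\<sigma> * k * M (- k) t) - (M k t - P k t) / 2"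
    unfolding P_def M_def trig_coeff_def using i by (simp add: diff_divide_distrib)
  finally show "(M k has_real_derivative - (\<sigma> * k * M (- k) t) - (M k t - P k t) / 2) (at t within {0..})"
    using weak(2) unfolding M_def trig_coeff_def by simp
qed

section \<open>Decay of the coefficients at opposite frequencies\<close>

definition coeff_energy ::
  "(real \<Rightarrow> real \<Rightarrow> real) \<Rightarrow> (real \<Rightarrow> real \<Rightarrow> real) \<Rightarrow> real \<Rightarrow> int \<Rightarrow> real \<Rightarrow> real" where
  "coeff_energy fp fm c k t
     = (trig_coeff k (\<lambda>x. fp x t - c))\<^sup>2 + (trig_coeff k (\<lambda>x. fm x t - c))\<^sup>2"

lemma coeff_energy_nonneg: "coeff_energy fp fm c k t \<ge> 0"
  by (simp add: coeff_energy_def)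

text \<open>For the coefficients at \<open>\<plusminus>k\<close> the sum \<open>f\<^sub>+ + f\<^sub>-\<close> at one sign couples only to the
  difference at the other sign, which splits the four equations into two copies of the system in
  \<open>mode_decay\<close>.\<close>
lemma coeff_energy_decay_nonzero:
  assumes sol: "two_velocity_solution \<sigma> fIp fIm fp fm" and t: "t \<ge> 0" and k: "(0::int) < k"
    and \<sigma>: "\<sigma> > 0"
    and \<Theta>: "\<Theta> < 1" "\<sigma> * k < 1/2 \<Longrightarrow> 2 * (\<sigma> * k) \<le> \<Theta>" "\<sigma> * k \<ge> 1/2 \<Longrightarrow> 1 / (2 * (\<sigma> * k)) \<le> \<Theta>"
    and lam: "0 \<le> lam" "lam \<le> 1/2" "lam * (1 - lam) \<le> \<sigma>\<^sup>2"
  shows "coeff_energy fp fm c k t + coeff_energy fp fm c (- k) t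
    \<le> (1 + \<Theta>) / (1 - \<Theta>) * exp (- (2 * lam) * t)
        * (coeff_energy fp fm c k 0 + coeff_energy fp fm c (- k) 0)"
proof -
  define P where "P k t = trig_coeff k (\<lambda>x. fp x t)" for k t
  define M where "M k t = trig_coeff k (\<lambda>x. fm x t)" for k t
  have dP: "(P k has_real_derivative \<sigma> * k * P (- k) t + (M k t - P k t) / 2) (at t within {0..})"
    and dM: "(M k has_real_derivative - (\<sigma> * k * M (- k) t) - (M k t - P k t) / 2) (at t within {0..})"
    if "t \<ge> 0" for t k
    using solution_trig_coeff_deriv[OF sol that, of k] unfolding P_def M_def by simp_all
  have \<kappa>: "0 < \<sigma> * k" using k \<sigma> by simp
  \<comment> \<open>Since \<open>k\<close> is at least 1, the first mode dictates the common
    rate.\<close>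
  have "\<sigma>\<^sup>2 \<le> (\<sigma> * k)\<^sup>2"
    using k \<sigma> by (intro power_mono) auto
  with lam(3) have lam3: "lam * (1 - lam) \<le> (\<sigma> * k)\<^sup>2" by linarith
  let ?C = "(1 + \<Theta>) / (1 - \<Theta>) * exp (- (2 * lam) * t)"
  \<comment> \<open>Each inequality takes the sum as \<open>y\<close> and the difference as
    \<open>z\<close>. The order of the difference is reversed between the two because transport
    carries the factor \<open>k\<close> in one case and \<open>- k\<close> in the other.\<close>
  have 1: "(P k t + M k t)\<^sup>2 + (M (- k) t - P (- k) t)\<^sup>2
    \<le> ?C * ((P k 0 + M k 0)\<^sup>2 + (M (- k) 0 - P (- k) 0)\<^sup>2)"
    by (rule mode_decay[OF _ _ \<kappa> \<Theta>(2,3,1) lam(1,2) lam3 t])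
      (auto intro!: derivative_eq_intros dP dM simp: field_simps)
  have 2: "(P (- k) t + M (- k) t)\<^sup>2 + (P k t - M k t)\<^sup>2
    \<le> ?C * ((P (- k) 0 + M (- k) 0)\<^sup>2 + (P k 0 - M k 0)\<^sup>2)"
    by (rule mode_decay[OF _ _ \<kappa> \<Theta>(2,3,1) lam(1,2) lam3 t])
      (auto intro!: derivative_eq_intros dP dM simp: field_simps)
  have E: "coeff_energy fp fm c j s = (P j s)\<^sup>2 + (M j s)\<^sup>2" if "j \<noteq> 0" "s \<ge> 0" for j s
    using that by (simp add: coeff_energy_def trig_coeff_diff_const solution_L2[OF sol] P_def M_def)
  \<comment> \<open>The parallelogram law recombines the two sums and two differences.\<close>
  have S: "2 * (coeff_energy fp fm c k s + coeff_energy fp fm c (- k) s)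
    = ((P k s + M k s)\<^sup>2 + (M (- k) s - P (- k) s)\<^sup>2) + ((P (- k) s + M (- k) s)\<^sup>2 + (P k s - M k s)\<^sup>2)"
    if "s \<ge> 0" for s
    using k that by (simp add: E power2_eq_square algebra_simps)
  have "2 * (coeff_energy fp fm c k t + coeff_energy fp fm c (- k) t)
    \<le> ?C * ((P k 0 + M k 0)\<^sup>2 + (M (- k) 0 - P (- k) 0)\<^sup>2)
      + ?C * ((P (- k) 0 + M (- k) 0)\<^sup>2 + (P k 0 - M k 0)\<^sup>2)"
    unfolding S[OF t] using 1 2 by (rule add_mono)
  also have "\<dots> = ?C * (2 * (coeff_energy fp fm c k 0 + coeff_energy fp fm c (- k) 0))"
    unfolding S[OF order_refl] by (simp only: distrib_left)
  finally have "2 * (coeff_energy fp fm c k t + coeff_energy fp fm c (- k) t)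
    \<le> ?C * (2 * (coeff_energy fp fm c k 0 + coeff_energy fp fm c (- k) 0))" .
  then have "2 * (coeff_energy fp fm c k t + coeff_energy fp fm c (- k) t)
    \<le> 2 * (?C * (coeff_energy fp fm c k 0 + coeff_energy fp fm c (- k) 0))"
    by (simp only: mult.left_commute)
  then show ?thesis by (rule mult_left_le_imp_le) simp
qed

text \<open>Without transport the sum of the two coefficients is conserved, and \<open>c\<close> is
  chosen so that this sum agrees with that of the constant state. Only the difference is left, and
  it decays like \<open>exp (- t)\<close>, faster than required.\<close>

lemma coeff_energy_decay_zero:
  assumes sol: "two_velocity_solution \<sigma> fIp fIm fp fm" and t: "t \<ge> 0"
    and lam: "lam \<le> 1/2"
    and c: "4 * pi * c = (LINT x|period_measure. fp x 0 + fm x 0)"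
  shows "coeff_energy fp fm c 0 t \<le> exp (- (2 * lam) * t) * coeff_energy fp fm c 0 0"
proof -
  define P where "P t = trig_coeff 0 (\<lambda>x. fp x t)" for t
  define M where "M t = trig_coeff 0 (\<lambda>x. fm x t)" for t
  have dP: "(P has_real_derivative (M t - P t) / 2) (at t within {0..})"
    and dM: "(M has_real_derivative - ((M t - P t) / 2)) (at t within {0..})"
    if "t \<ge> 0" for t
    using solution_trig_coeff_deriv[OF sol that, of 0] unfolding P_def[abs_def] M_def[abs_def] by simp_all
  have PM0: "P 0 + M 0 = 4 * pi * c"
    using L2_per_integrable[OF solution_L2(1)[OF sol order_refl]]
      L2_per_integrable[OF solution_L2(2)[OF sol order_refl]]
    by (simp add: P_def M_def trig_coeff_def trig_def c)
  have "\<exists>a. \<forall>s\<in>{0..}. P s + M s = a"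
    by (rule has_field_derivative_zero_constant) (auto intro!: derivative_eq_intros dP dM)
  then have PM: "P s + M s = 4 * pi * c" if "s \<ge> 0" for s
    using PM0 that by (metis atLeast_iff order_refl)
  have E: "2 * coeff_energy fp fm c 0 s = (P s - M s)\<^sup>2" if "s \<ge> 0" for s
  proof -
    have "coeff_energy fp fm c 0 s = (P s - 2 * pi * c)\<^sup>2 + (M s - 2 * pi * c)\<^sup>2"
      using that by (simp add: coeff_energy_def trig_coeff_diff_const solution_L2[OF sol] P_def M_def)
    moreover have "2 * pi * c = (P s + M s) / 2" using PM[OF that] by simp
    moreover have "2 * ((a - (a + b) / 2)\<^sup>2 + (b - (a + b) / 2)\<^sup>2) = (a - b)\<^sup>2" for a b :: real
      by (simp add: power2_eq_square field_simps)
    ultimately show ?thesis by simp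
  qed
  have "(P t - M t)\<^sup>2 \<le> exp (- (2 * lam) * t) * (P 0 - M 0)\<^sup>2"
  proof (rule gronwall_decay[OF _ _ t])
    show "((\<lambda>t. (P t - M t)\<^sup>2) has_real_derivative - 2 * (P s - M s)\<^sup>2) (at s within {0..})"
      if "s \<ge> 0" for s
      using that by (auto intro!: derivative_eq_intros dP dM simp: power2_eq_square field_simps)
    show "- 2 * (P s - M s)\<^sup>2 \<le> - (2 * lam * (P s - M s)\<^sup>2)" for s
      using mult_right_mono[of "2 * lam" 2 "(P s - M s)\<^sup>2"] lam by simp
  qed
  then have "2 * coeff_energy fp fm c 0 t \<le> 2 * (exp (- (2 * lam) * t) * coeff_energy fp fm c 0 0)"
    unfolding mult.left_commute[of 2] E[OF t] E[OF order_refl] .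
  then show ?thesis by (rule mult_left_le_imp_le) simp
qed

section \<open>Summation over the modes\<close>

theorem theorem6:
  fixes \<sigma> :: real
  assumes "\<sigma> > 0" and "1 / (2 * \<sigma>) \<notin> \<nat>"
  shows "\<exists>c>0. \<forall>fIp fIm fp fm.
    L2_per fIp \<and> L2_per fIm \<and> two_velocity_solution \<sigma> fIp fIm fp fm \<longrightarrow>
    (let finf = (1 / (4 * pi)) * (LINT x:{0..2*pi}|lborel. fIp x + fIm x);
         lam = Re (1/2 - csqrt (complex_of_real (1/4 - \<sigma>\<^sup>2)))
     in \<forall>t\<ge>0. L2_norm2 (\<lambda>x. fp x t - finf) (\<lambda>x. fm x t - finf)
           \<le> c * exp (- lam * t) * L2_norm2 (\<lambda>x. fIp x - finf) (\<lambda>x. fIm x - finf))"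
proof -
  obtain \<Theta> where \<Theta>: "0 < \<Theta>" "\<Theta> < 1"
    "\<And>k. (0::int) < k \<Longrightarrow> \<sigma> * k < 1/2 \<Longrightarrow> 2 * (\<sigma> * k) \<le> \<Theta>"
    "\<And>k. (0::int) < k \<Longrightarrow> \<sigma> * k \<ge> 1/2 \<Longrightarrow> 1 / (2 * (\<sigma> * k)) \<le> \<Theta>"
    using spectral_gap_uniform[OF assms] by blast
  \<comment> \<open>The ratio of the two comparison constants of the Lyapunov form; it depends on
    \<sigma> alone, so it can be fixed before the data. \<open>C \<ge> 1\<close> lets it cover the
    zero mode too.\<close>
  define C where "C = (1 + \<Theta>) / (1 - \<Theta>)"
  have C: "C \<ge> 1" using \<Theta>(1,2) by (simp add: C_def)
  define lam where "lam = Re (1/2 - csqrt (complex_of_real (1/4 - \<sigma>\<^sup>2)))"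
  note lam = decay_rate[OF assms(1), folded lam_def]
  have main: "L2_norm2 (\<lambda>x. fp x t - c) (\<lambda>x. fm x t - c)
      \<le> sqrt C * exp (- lam * t) * L2_norm2 (\<lambda>x. fIp x - c) (\<lambda>x. fIm x - c)"
    if L2I: "L2_per fIp" "L2_per fIm" and sol: "two_velocity_solution \<sigma> fIp fIm fp fm"
      and c: "c = (1 / (4 * pi)) * (LINT x:{0..2*pi}|lborel. fIp x + fIm x)" and t: "t \<ge> 0"
    for fIp fIm fp fm c t
  proof -
    note L2 = solution_L2[OF sol]
    note L2c = L2[THEN L2_per_diff[OF _ L2_per_const]]
    have init: "AE x in period_measure. fp x 0 = fIp x \<and> fm x 0 = fIm x"
      unfolding AE_period_iff using sol by (auto simp: two_velocity_solution_def)
    have "(LINT x|period_measure. fp x 0 + fm x 0) = (LINT x|period_measure. fIp x + fIm x)"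
      using init L2[OF order_refl] L2I
      by (intro integral_cong_AE borel_measurable_add L2_per_measurable) auto
    then have c0: "4 * pi * c = (LINT x|period_measure. fp x 0 + fm x 0)"
      unfolding c set_integral_period by simp
    define X where "X s = (LINT x|period_measure. (fp x s - c)\<^sup>2) + (LINT x|period_measure. (fm x s - c)\<^sup>2)" for s
    define W where "W N s = (\<Sum>k\<in>{- int N..int N}. trig_weight k * coeff_energy fp fm c k s)" for N s
    have W_eq: "W N s = trig_energy N (\<lambda>x. fp x s - c) + trig_energy N (\<lambda>x. fm x s - c)" for N s
      by (simp add: W_def trig_energy_def coeff_energy_def distrib_left sum.distrib)
    have W_lim: "(\<lambda>N. W N s) \<longlonglongrightarrow> X s" if "s \<ge> 0" for s
      unfolding W_eq X_def by (intro tendsto_add parseval L2c that)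
    \<comment> \<open>The decay estimate concerns the joint energy at \<open>k\<close> and
      \<open>- k\<close>. The weights and the range are symmetric, so doubling the sum pairs the
      frequencies.\<close>
    have W_sym: "2 * W N s = (\<Sum>k\<in>{- int N..int N}.
        trig_weight k * (coeff_energy fp fm c k s + coeff_energy fp fm c (- k) s))" for N s
    proof -
      have "W N s = (\<Sum>k\<in>{- int N..int N}. trig_weight (- k) * coeff_energy fp fm c (- k) s)"
        unfolding W_def by (rule sum.reindex_bij_witness[of _ uminus uminus]) auto
      then have "W N s + W N s = (\<Sum>k\<in>{- int N..int N}. trig_weight k * coeff_energy fp fm c k s)
         + (\<Sum>k\<in>{- int N..int N}. trig_weight k * coeff_energy fp fm c (- k) s)"
        by (simp add: W_def trig_weight_def)
      then show ?thesis by (simp add: distrib_left sum.distrib)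
    qed
    let ?K = "C * exp (- (2 * lam) * t)"
    have mode: "coeff_energy fp fm c k t + coeff_energy fp fm c (- k) t
      \<le> ?K * (coeff_energy fp fm c k 0 + coeff_energy fp fm c (- k) 0)" for k
    proof -
      have nz: "coeff_energy fp fm c k t + coeff_energy fp fm c (- k) t
        \<le> ?K * (coeff_energy fp fm c k 0 + coeff_energy fp fm c (- k) 0)" if "0 < k" for k
        unfolding C_def
        by (rule coeff_energy_decay_nonzero[OF sol t that assms(1) \<Theta>(2) _ _ lam])
          (rule \<Theta>(3,4)[OF that], assumption)+
      consider "0 < k" | "k = 0" | "0 < - k" by linarith
      then show ?thesis
      proof cases
        case 1
        then show ?thesis by (rule nz)
      next
        case 2
        have "coeff_energy fp fm c 0 t \<le> exp (- (2 * lam) * t) * coeff_energy fp fm c 0 0"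
          by (rule coeff_energy_decay_zero[OF sol t lam(2) c0])
        also have "\<dots> \<le> C * (exp (- (2 * lam) * t) * coeff_energy fp fm c 0 0)"
          using C coeff_energy_nonneg[of fp fm c 0 0] by (intro mult_right_mono[of 1 C, simplified]) auto
        finally show ?thesis using 2 by simp
      next
        case 3
        then show ?thesis using nz[of "- k"] by (simp add: add.commute)
      qed
    qed
    have "W N t \<le> ?K * W N 0" for N
    proof -
      have "2 * W N t \<le> (\<Sum>k\<in>{- int N..int N}.
          trig_weight k * (?K * (coeff_energy fp fm c k 0 + coeff_energy fp fm c (- k) 0)))"
        unfolding W_sym by (intro sum_mono mult_left_mono mode less_imp_le[OF trig_weight_pos])
      also have "\<dots> = ?K * (2 * W N 0)"
        unfolding W_sym sum_distrib_left by (simp add: mult_ac)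
      finally show ?thesis by simp
    qed
    \<comment> \<open>The factor is independent of \<open>N\<close>, so Parseval at the times
      \<open>t\<close> and 0 passes the bound to the limit.\<close>
    then have X: "X t \<le> ?K * X 0"
      by (intro LIMSEQ_le[OF W_lim[OF t] tendsto_mult[OF tendsto_const W_lim[OF order_refl]]]) auto
    have norm_eq: "L2_norm2 g h = sqrt ((LINT x|period_measure. (g x)\<^sup>2) + (LINT x|period_measure. (h x)\<^sup>2))"
      if "L2_per g" "L2_per h" for g h
      using that[THEN L2_per_square] by (simp add: L2_norm2_def set_integral_period)
    have X0: "L2_norm2 (\<lambda>x. fIp x - c) (\<lambda>x. fIm x - c) = sqrt (X 0)"
    proof -
      have "(LINT x|period_measure. (fp x 0 - c)\<^sup>2) = (LINT x|period_measure. (fIp x - c)\<^sup>2)"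
        "(LINT x|period_measure. (fm x 0 - c)\<^sup>2) = (LINT x|period_measure. (fIm x - c)\<^sup>2)"
        using init
        by (intro integral_cong_AE borel_measurable_power borel_measurable_diff borel_measurable_const
            L2_per_measurable L2[OF order_refl] L2I; auto)+
      then show ?thesis
        using L2I by (simp add: norm_eq L2_per_diff L2_per_const X_def)
    qed
    have "L2_norm2 (\<lambda>x. fp x t - c) (\<lambda>x. fm x t - c) = sqrt (X t)"
      using L2c[OF t] by (simp add: norm_eq X_def)
    also have "\<dots> \<le> sqrt (?K * X 0)" using X by (rule real_sqrt_le_mono)
    also have "\<dots> = sqrt C * exp (- lam * t) * sqrt (X 0)"
    \<comment> \<open>Norms are square roots of energies, which halves the exponent and turns
      \<open>C\<close> into \<open>sqrt C\<close>.\<close>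
    proof -
      have "exp (- (2 * lam) * t) = (exp (- lam * t))\<^sup>2"
        by (simp add: power2_eq_square flip: exp_add)
      then show ?thesis by (simp add: real_sqrt_mult)
    qed
    finally show ?thesis unfolding X0 .
  qed
  show ?thesis
    unfolding Let_def lam_def[symmetric]
    using main C by (intro exI[of _ "sqrt C"]) auto
qed

end
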